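(* Let $n, m, k$ be integers with $n, k \ge 3$ and $m \ge 2$. Then the minimum cardinality of a doubly resolving set of the layer Sun graph $LSG(n,m,k)$ is $nm^{k-2}$.
   Context: All graphs are finite, simple and connected; $d(x,y)$ denotes the length of a shortest path between vertices $x$ and $y$. Layer Sun graph: for integers $n,k\ge 3$ and $m\ge 2$, the graph $LSG(n,m,k)$ has vertex set partitioned into layers $V_1\cup V_2\cup\dots\cup V_k$. The layer $V_1=\{1,2,\dots,n\}$ induces the cycle $C_n$. The layer $V_2=\{v_1,\dots,v_n\}$ has $n$ vertices, and each cycle vertex $i$ is adjacent to exactly one vertex of $V_2$, namely $v_i$. For $3\le l\le k$, the layer $V_l$ has $nm^{l-2}$ vertices and is partitioned into $nm^{l-3}$ sets (components) $B^{(l)}_{ij}$, $1\le i\le n$, $1\le j\le m^{l-3}$, each consisting of $m$ pairwise non-adjacent vertices. Each $v_i\in V_2$ is adjacent to all $m$ vertices of $B^{(3)}_{i1}$, and, for $3\le l\le k-1$ and each $i$, the $m^{l-2}$ vertices of $\bigcup_j B^{(l)}_{ij}$ are in bijection with the $m^{l-2}$ components $B^{(l+1)}_{i1},\dots,B^{(l+1)}_{i\,m^{l-2}}$ of $V_{l+1}$, each vertex being adjacent to all $m$ vertices of its corresponding component. There are no other edges. Equivalently, $LSG(n,m,k)$ is obtained from $C_n$ by attaching to each cycle vertex $i$, by an edge to its root $v_i$, a rooted tree in which the root has level $2$, every vertex of level $2,\dots,k-1$ has exactly $m$ children, and the vertices of level $k$ are leaves. The graph has order $2n+\sum_{r=1}^{k-2}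 nm^r$. Doubly resolving sets: vertices $x,y$ of a graph $G$ doubly resolve vertices $u,v$ of $G$ if $d(u,x)-d(u,y)\ne d(v,x)-d(v,y)$. A set $S$ of vertices of $G$ is a doubly resolving set of $G$ if every two distinct vertices of $G$ are doubly resolved by some two vertices of $S$. The minimum cardinality of a doubly resolving set is denoted $\psi(G)$. *)

theory Defs
  imports "Graph_Theory.Graph_Theory"
begin

text \<open>
  A simple graph is a symmetric loop-free digraph without parallel arcs, as in the locale
  \<^locale>\<open>pair_graph\<close>; each undirected edge is a pair of opposite arcs.
  A path is an \<open>apath\<close>, i.e. a walk without repeated vertices.
\<close>

definition gdist :: "('a, 'b) pre_digraph \<Rightarrow> 'a \<Rightarrow> 'a \<Rightarrow> nat" where
  "gdist G u v = (LEAST l. \<exists>p. pre_digraph.apath G u p v \<and> length p = l)"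

definition doubly_resolve :: "('a, 'b) pre_digraph \<Rightarrow> 'a \<Rightarrow> 'a \<Rightarrow> 'a \<Rightarrow> 'a \<Rightarrow> bool" where
  "doubly_resolve G x y u v \<longleftrightarrow>
     int (gdist G u x) - int (gdist G u y) \<noteq> int (gdist G v x) - int (gdist G v y)"

definition doubly_resolving_set :: "('a, 'b) pre_digraph \<Rightarrow> 'a set \<Rightarrow> bool" where
  "doubly_resolving_set G S \<longleftrightarrow> S \<subseteq> verts G \<and>
     (\<forall>u \<in> verts G. \<forall>v \<in> verts G. u \<noteq> v \<longrightarrow> (\<exists>x \<in> S. \<exists>y \<in> S. doubly_resolve G x y u v))"

definition psi :: "('a, 'b) pre_digraph \<Rightarrow> nat" where
  "psi G = (LEAST s. \<exists>S. finite S \<and> doubly_resolving_set G S \<and> card S = s)"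

text \<open>
  \<open>Cyc i\<close> is the cycle vertex \<open>i + 1\<close> of layer 1 (indices start at 0 here), and \<open>Node i w\<close> is
  the vertex of layer \<open>length w + 2\<close> in the tree attached to \<open>Cyc i\<close> that is reached from the
  root \<open>v\<^sub>i = Node i []\<close> by the child choices \<open>w\<close>, the most recent choice first.  Thus the children
  of \<open>Node i w\<close> are the \<open>Node i (c # w)\<close> with \<open>c < m\<close>, and they form one component \<open>B\<close> of their
  layer.
\<close>

datatype lsg_vertex = Cyc nat | Node nat "nat list"

definition LSG_verts :: "nat \<Rightarrow> nat \<Rightarrow> nat \<Rightarrow> lsg_vertex set" where
  "LSG_verts n m k = {Cyc i | i. i < n}
     \<union> {Node i w | i w. i < n \<and> set w \<subseteq> {..<m} \<and> length w + 2 \<le> k}"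

definition LSG_edges :: "nat \<Rightarrow> nat \<Rightarrow> nat \<Rightarrow> (lsg_vertex \<times> lsg_vertex) set" where
  "LSG_edges n m k = {(Cyc i, Cyc (Suc i mod n)) | i. i < n}
     \<union> {(Cyc i, Node i []) | i. i < n}
     \<union> {(Node i w, Node i (c # w)) | i w c.
          i < n \<and> c < m \<and> set w \<subseteq> {..<m} \<and> length w + 3 \<le> k}"

definition LSG :: "nat \<Rightarrow> nat \<Rightarrow> nat \<Rightarrow> lsg_vertex pair_pre_digraph" where
  "LSG n m k = \<lparr> pverts = LSG_verts n m k, parcs = LSG_edges n m k \<union> (LSG_edges n m k)\<inverse> \<rparr>"

lemma LSG_verts_conv:
  "k \<ge> 2 \<Longrightarrow> LSG_verts n m k = Cyc ` {..<n} \<union>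
     (\<lambda>(i, w). Node i w) ` ({..<n} \<times> {w. set w \<subseteq> {..<m} \<and> length w \<le> k - 2})"
  unfolding LSG_verts_def by auto

lemma card_LSG_verts:
  assumes "k \<ge> 3"
  shows "card (pverts (LSG n m k)) = 2 * n + (\<Sum>r = 1..k - 2. n * m ^ r)"
proof -
  let ?L = "{w. set w \<subseteq> {..<m} \<and> length w \<le> k - 2}"
  have fin: "finite ?L" by (simp add: finite_lists_length_le)
  have "card (LSG_verts n m k) = card (Cyc ` {..<n}) + card ((\<lambda>(i, w). Node i w) ` ({..<n} \<times> ?L))"
    using assms fin by (subst LSG_verts_conv, simp, intro card_Un_disjoint) auto
  also have "card (Cyc ` {..<n}) = n"
    by (subst card_image) (auto simp: inj_on_def)
  also have "card ((\<lambda>(i, w). Node i w) ` ({..<n} \<times> ?L)) = n * card ?L"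
    by (subst card_image) (auto simp: inj_on_def card_cartesian_product)
  also have "card ?L = (\<Sum>r\<le>k - 2. m ^ r)"
    by (simp add: card_lists_length_le)
  also have "\<dots> = 1 + (\<Sum>r = 1..k - 2. m ^ r)"
    by (simp add: atMost_atLeast0 sum.atLeast_Suc_atMost)
  finally show ?thesis by (simp add: LSG_def sum_distrib_left algebra_simps)
qed

lemma pair_graph_LSG:
  assumes "n \<ge> 3" and "k \<ge> 3"
  shows "pair_graph (LSG n m k)"
proof -
  have sub: "parcs (LSG n m k) \<subseteq> LSG_verts n m k \<times> LSG_verts n m k"
    using assms unfolding LSG_def LSG_edges_def LSG_verts_def by auto
  have fin: "finite (LSG_verts n m k)"
    using assms by (subst LSG_verts_conv) (auto simp: finite_lists_length_le)
  have irr: "i < n \<Longrightarrow> Suc i mod n \<noteq> i" for i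
    using assms by (cases "Suc i = n") auto
  show ?thesis
  proof unfold_locales
    fix e assume e: "e \<in> parcs (LSG n m k)"
    then show "fst e \<in> pverts (LSG n m k)" "snd e \<in> pverts (LSG n m k)"
      using sub by (auto simp: LSG_def)
    show "fst e \<noteq> snd e" using e irr by (auto simp: LSG_def LSG_edges_def; metis)
  next
    show "finite (pverts (LSG n m k))" using fin by (simp add: LSG_def)
    show "finite (parcs (LSG n m k))" using sub fin finite_subset by blast
    show "symmetric (LSG n m k)" by (auto simp: symmetric_def sym_def LSG_def)
  qed
qed

lemma strongly_connected_LSG:
  assumes "n \<ge> 3" and "k \<ge> 3"
  shows "strongly_connected (LSG n m k)"
proof -
  interpret pair_graph "LSG n m k" using assms by (rule pair_graph_LSG)
  let ?G = "with_proj (LSG n m k)"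
  have sym: "v \<rightarrow>\<^sup>*\<^bsub>?G\<^esub> u" if "u \<rightarrow>\<^sup>*\<^bsub>?G\<^esub> v" for u v
    using that symmetric_reachable[OF sym_arcs] by blast
  have edge: "u \<rightarrow>\<^sup>*\<^bsub>?G\<^esub> v" if "(u, v) \<in> LSG_edges n m k" for u v
    using that by (intro reachable_adjI) (simp add: LSG_def)
  have cyc: "i < n \<Longrightarrow> Cyc 0 \<rightarrow>\<^sup>*\<^bsub>?G\<^esub> Cyc i" for i
  proof (induction i)
    case 0
    then show ?case by (intro reachable_refl) (auto simp: LSG_def LSG_verts_def)
  next
    case (Suc i)
    then have "(Cyc i, Cyc (Suc i mod n)) \<in> LSG_edges n m k"
      unfolding LSG_edges_def by fastforce
    then have "Cyc i \<rightarrow>\<^sup>*\<^bsub>?G\<^esub> Cyc (Suc i)" using edge Suc.prems by force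
    then show ?case using Suc reachable_trans Suc_lessD by metis
  qed
  have node: "i < n \<Longrightarrow> set w \<subseteq> {..<m} \<Longrightarrow> length w + 2 \<le> k \<Longrightarrow> Cyc 0 \<rightarrow>\<^sup>*\<^bsub>?G\<^esub> Node i w" for i w
  proof (induction w)
    case Nil
    then have "Cyc i \<rightarrow>\<^sup>*\<^bsub>?G\<^esub> Node i []" by (intro edge) (auto simp: LSG_edges_def)
    then show ?case using cyc Nil reachable_trans by metis
  next
    case (Cons c w)
    then have "Node i w \<rightarrow>\<^sup>*\<^bsub>?G\<^esub> Node i (c # w)" by (intro edge) (auto simp: LSG_edges_def)
    moreover have "Cyc 0 \<rightarrow>\<^sup>*\<^bsub>?G\<^esub> Node i w" using Cons by auto
    ultimately show ?case using reachable_trans by metis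
  qed
  have all: "Cyc 0 \<rightarrow>\<^sup>*\<^bsub>?G\<^esub> v" if "v \<in> LSG_verts n m k" for v
    using that cyc node unfolding LSG_verts_def by auto
  show ?thesis
  proof (rule strongly_connectedI)
    have "Cyc 0 \<in> LSG_verts n m k" using assms by (auto simp: LSG_verts_def)
    then show "verts (LSG n m k) \<noteq> {}" by (auto simp: LSG_def)
    fix u v assume "u \<in> verts (LSG n m k)" "v \<in> verts (LSG n m k)"
    then have "Cyc 0 \<rightarrow>\<^sup>*\<^bsub>?G\<^esub> u" "Cyc 0 \<rightarrow>\<^sup>*\<^bsub>?G\<^esub> v"
      using all by (simp_all add: LSG_def)
    then show "u \<rightarrow>\<^sup>*\<^bsub>?G\<^esub> v" using sym reachable_trans by metis
  qed
qed

end

theory Submission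
  imports Defs
begin

text \<open>
  The leaves of \<open>LSG n m k\<close>, that is its vertices of degree 1, form the unique smallest doubly
  resolving set, and there are \<open>n * m ^ (k - 2)\<close> of them.

  Both halves rest on \<open>gdist_through_gate\<close>: if a set \<open>A\<close> of vertices can only be entered through
  the single vertex \<open>u\<close>, then distances from outside \<open>A\<close> to inside \<open>A\<close> split additively at \<open>u\<close>.

  A leaf \<open>x\<close> with neighbour \<open>p\<close> is contained in every doubly resolving set, because everything
  else can only be reached from \<open>x\<close> through \<open>p\<close>: the distances from \<open>x\<close> and from \<open>p\<close> to all
  vertices other than \<open>x\<close> differ by the same amount, so a pair without \<open>x\<close> cannot doubly resolve
  \<open>x\<close> and \<open>p\<close>.

  Conversely, for any two vertices \<open>u\<close> and \<open>v\<close> some geodesic from \<open>v\<close> to \<open>u\<close> extends beyond \<open>u\<close>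
  to a leaf \<open>x\<close>: from \<open>u\<close> one walks down into a branch that does not contain \<open>v\<close>, which exists
  because \<open>m \<ge> 2\<close>, or, if \<open>u\<close> is a cycle vertex and \<open>v\<close> lies in its own tree, into the tree of
  another cycle vertex. Exchanging the roles of \<open>u\<close> and \<open>v\<close> yields a leaf \<open>y\<close>. Passing from \<open>u\<close>
  to \<open>v\<close> increases the distance to \<open>x\<close> and decreases the distance to \<open>y\<close>, so \<open>x\<close> and \<open>y\<close> doubly
  resolve \<open>u\<close> and \<open>v\<close>.
\<close>

section \<open>Distances in digraphs\<close>

context wf_digraph
begin

lemma awalk_contains_apath:
  assumes "awalk u p v"
  shows "\<exists>q. apath u q v \<and> length q \<le> length p"
  using assms
proof (induct rule: awalk_to_apath_induct)
  case (path p)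
  then show ?case by (auto simp: apath_def)
next
  case (decomp p q r s)
  then have "p = q @ r @ s" using awalk_cyc_decomp_has_prop[of u p v] by auto
  with decomp show ?case by fastforce
qed

lemma gdist_le_awalk:
  assumes "awalk u p v"
  shows "gdist G u v \<le> length p"
proof -
  obtain q where q: "apath u q v" "length q \<le> length p"
    using awalk_contains_apath[OF assms] by blast
  have "gdist G u v \<le> length q" unfolding gdist_def by (rule Least_le) (use q in blast)
  with q show ?thesis by simp
qed

lemma gdist_awalkE:
  assumes "u \<rightarrow>\<^sup>* v"
  obtains p where "awalk u p v" "length p = gdist G u v"
proof -
  obtain q where "apath u q v" using assms reachable_apath by blast
  then have "\<exists>l p. apath u p v \<and> length p = l" by blast
  then have "\<exists>p. apath u p v \<and> length p = gdist G u v" unfolding gdist_def by (rule LeastI_ex)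
  with that show thesis by (blast intro: awalkI_apath)
qed

lemma gdist_triangle:
  assumes "u \<rightarrow>\<^sup>* v" "v \<rightarrow>\<^sup>* w"
  shows "gdist G u w \<le> gdist G u v + gdist G v w"
proof -
  obtain p where p: "awalk u p v" "length p = gdist G u v" using assms gdist_awalkE by blast
  obtain q where q: "awalk v q w" "length q = gdist G v w" using assms gdist_awalkE by blast
  have "awalk u (p @ q) w" using p q awalk_appendI by blast
  from gdist_le_awalk[OF this] p q show ?thesis by simp
qed

lemma gdist_pos:
  assumes "u \<rightarrow>\<^sup>* v" "u \<noteq> v"
  shows "gdist G u v > 0"
proof -
  obtain p where "awalk u p v" "length p = gdist G u v" using assms gdist_awalkE by blast
  with assms show ?thesis by (cases p) (auto simp: awalk_Nil_iff)
qed

lemma awalk_splits_at_gate: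
  assumes "awalk v p x" "v \<notin> A" "x \<in> A"
    and "\<And>e. e \<in> arcs G \<Longrightarrow> tail G e \<notin> A \<Longrightarrow> head G e \<in> A \<Longrightarrow> head G e = u"
  shows "\<exists>q r. p = q @ r \<and> awalk v q u \<and> awalk u r x"
  using assms(1,2)
proof (induction p arbitrary: v)
  case Nil
  with assms(3) show ?case by (auto simp: awalk_Nil_iff)
next
  case (Cons e p)
  then have e: "e \<in> arcs G" "v = tail G e" "awalk (head G e) p x"
    by (auto simp: awalk_Cons_iff)
  show ?case
  proof (cases "head G e \<in> A")
    case True
    then have "head G e = u" using assms(4) e Cons.prems by blast
    then have "e # p = [e] @ p" "awalk v [e] u" "awalk u p x"
      using e arc_implies_awalk by auto
    then show ?thesis by blast
  next
    case False
    then obtain q r where "p = q @ r" "awalk (head G e) q u" "awalk u r x"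
      using Cons.IH e by blast
    then have "e # p = (e # q) @ r" "awalk v (e # q) u" "awalk u r x"
      using e by (auto simp: awalk_Cons_iff)
    then show ?thesis by blast
  qed
qed

text \<open>
  A shortest walk from \<open>v\<close> to \<open>x\<close> has to enter \<open>A\<close>, hence to visit \<open>u\<close>, so the triangle inequality
  at \<open>u\<close> is sharp.
\<close>

lemma gdist_through_gate:
  assumes "v \<rightarrow>\<^sup>* x" "v \<notin> A" "x \<in> A"
    and "\<And>e. e \<in> arcs G \<Longrightarrow> tail G e \<notin> A \<Longrightarrow> head G e \<in> A \<Longrightarrow> head G e = u"
  shows "gdist G v x = gdist G v u + gdist G u x"
proof -
  obtain p where p: "awalk v p x" "length p = gdist G v x" using assms(1) gdist_awalkE by blast
  obtain q r where qr: "p = q @ r" "awalk v q u" "awalk u r x"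
    using awalk_splits_at_gate[OF p(1) assms(2-4)] by blast
  then have "gdist G v u + gdist G u x \<le> gdist G v x"
    using gdist_le_awalk[OF qr(2)] gdist_le_awalk[OF qr(3)] p(2) by simp
  moreover have "gdist G v x \<le> gdist G v u + gdist G u x"
    using qr gdist_triangle reachable_awalk by blast
  ultimately show ?thesis by simp
qed

end

section \<open>Criteria for double resolution\<close>

context wf_digraph
begin

lemma doubly_resolve_by_extended_geodesics:
  assumes "gdist G v x = gdist G v u + gdist G u x"
    and "gdist G u y = gdist G u v + gdist G v y"
    and "u \<rightarrow>\<^sup>* v" "u \<noteq> v"
  shows "doubly_resolve G x y u v"
  using assms(1,2) gdist_pos[OF assms(3,4)] by (simp add: doubly_resolve_def)

text \<open>
  Every vertex other than \<open>x\<close> is equally much farther from \<open>x\<close> than from \<open>p\<close>, so no pair of such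
  vertices tells \<open>x\<close> and \<open>p\<close> apart.
\<close>

lemma pendant_in_doubly_resolving_set:
  assumes "doubly_resolving_set G S" "strongly_connected G"
    and "x \<in> verts G" "p \<in> verts G" "p \<noteq> x"
    and pendant: "\<And>e. e \<in> arcs G \<Longrightarrow> tail G e = x \<Longrightarrow> head G e = p"
  shows "x \<in> S"
proof (rule ccontr)
  assume "x \<notin> S"
  obtain y z where yz: "y \<in> S" "z \<in> S" and res: "doubly_resolve G y z x p"
    using assms(1,3-5) unfolding doubly_resolving_set_def by metis
  have "gdist G x s = gdist G x p + gdist G p s" if "s \<in> S" for s
  proof (rule gdist_through_gate)
    show "x \<rightarrow>\<^sup>* s"
      using assms(1-3) that by (auto simp: doubly_resolving_set_def elim!: strongly_connectedE)
    show "x \<notin> - {x}" "s \<in> - {x}" using \<open>x \<notin> S\<close> that by auto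
  qed (use pendant in auto)
  with yz res show False by (simp add: doubly_resolve_def)
qed

end

section \<open>Cut vertices of the layer Sun graph\<close>

text \<open>
  The subtree hanging from \<open>Node i w\<close>. Child choices are stored with the most recent one first,
  so a descendant carries \<open>w\<close> as a suffix. Descendants are not restricted to the vertices of a
  particular graph, since only the arcs that cross the boundary matter.
\<close>

definition subtree :: "nat \<Rightarrow> nat list \<Rightarrow> lsg_vertex set" where
  "subtree i w = {Node i (w' @ w) | w'. True}"

fun parent :: "nat \<Rightarrow> nat list \<Rightarrow> lsg_vertex" where
  "parent i [] = Cyc i"
| "parent i (c # w) = Node i w"

lemma Node_in_subtree_iff: "Node j w' \<in> subtree i w \<longleftrightarrow> j = i \<and> (\<exists>t. w' = t @ w)"
  by (auto simp: subtree_def)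

lemma Cyc_notin_subtree [simp]: "Cyc j \<notin> subtree i w"
  by (auto simp: subtree_def)

lemma arc_LSG_cases:
  assumes "(a, b) \<in> parcs (LSG n m k)"
  obtains (cyc) i j where "a = Cyc i" "b = Cyc j"
    | (down) i w where "a = parent i w" "b = Node i w"
    | (up) i w where "a = Node i w" "b = parent i w"
proof -
  have edge: "(\<exists>i j. a = Cyc i \<and> b = Cyc j) \<or> (\<exists>i w. a = parent i w \<and> b = Node i w)"
    if "(a, b) \<in> LSG_edges n m k" for a b
  proof -
    from that consider i j where "a = Cyc i" "b = Cyc j"
      | i where "a = Cyc i" "b = Node i []"
      | i w c where "a = Node i w" "b = Node i (c # w)"
      unfolding LSG_edges_def by blast
    then show ?thesis by cases (metis parent.simps)+
  qed
  from assms have "(a, b) \<in> LSG_edges n m k \<or> (b, a) \<in> LSG_edges n m k"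
    by (simp add: LSG_def)
  with edge[of a b] edge[of b a] cyc down up show thesis by blast
qed

lemma parent_in_subtree_iff:
  "parent j w' \<in> subtree i w \<longleftrightarrow> Node j w' \<in> subtree i w \<and> Node j w' \<noteq> Node i w"
  by (cases w') (auto simp: subtree_def Cons_eq_append_conv)

lemma arc_into_subtree:
  assumes "(a, b) \<in> parcs (LSG n m k)" "a \<notin> subtree i w" "b \<in> subtree i w"
  shows "b = Node i w"
  using assms(1)
  by (cases rule: arc_LSG_cases) (use assms(2,3) parent_in_subtree_iff in auto)

lemma arc_out_of_subtree:
  assumes "(a, b) \<in> parcs (LSG n m k)" "a \<in> subtree i w" "b \<notin> subtree i w"
  shows "b = parent i w"
  using assms(1)
  by (cases rule: arc_LSG_cases) (use assms(2,3) parent_in_subtree_iff in auto)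

lemma arc_into_branch:
  assumes "(a, b) \<in> parcs (LSG n m k)"
    and "a \<notin> insert (Cyc i) (subtree i [])" "b \<in> insert (Cyc i) (subtree i [])"
  shows "b = Cyc i"
proof (rule ccontr)
  assume "b \<noteq> Cyc i"
  with assms have "a \<notin> subtree i []" "b \<in> subtree i []" by auto
  with assms(1) show False
  proof (cases rule: arc_LSG_cases)
    case (down j w)
    with \<open>a \<notin> subtree i []\<close> \<open>b \<in> subtree i []\<close> have "a = Cyc i"
      by (cases w) (auto simp: Node_in_subtree_iff)
    with assms(2) show False by simp
  qed (use parent_in_subtree_iff in auto)
qed

lemma reachable_LSG:
  assumes "n \<ge> 3" "k \<ge> 3" "u \<in> pverts (LSG n m k)" "v \<in> pverts (LSG n m k)"
  shows "u \<rightarrow>\<^sup>*\<^bsub>LSG n m k\<^esub> v"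
  using strongly_connected_LSG[OF assms(1,2), of m] assms(3,4)
  by (auto simp: strongly_connected_def)

section \<open>Leaves\<close>

definition leaves :: "nat \<Rightarrow> nat \<Rightarrow> nat \<Rightarrow> lsg_vertex set" where
  "leaves n m k = {Node i w | i w. i < n \<and> set w \<subseteq> {..<m} \<and> length w = k - 2}"

lemma finite_leaves_card_leaves:
  shows "finite (leaves n m k)" and "card (leaves n m k) = n * m ^ (k - 2)"
proof -
  let ?W = "{w. set w \<subseteq> {..<m} \<and> length w = k - 2}"
  have eq: "leaves n m k = (\<lambda>(i, w). Node i w) ` ({..<n} \<times> ?W)"
    unfolding leaves_def by auto
  have fin: "finite ?W" by (rule finite_lists_length_eq) simp
  then show "finite (leaves n m k)" by (simp add: eq)
  have "card (leaves n m k) = card ({..<n} \<times> ?W)"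
    unfolding eq by (rule card_image) (auto simp: inj_on_def)
  then show "card (leaves n m k) = n * m ^ (k - 2)"
    by (simp add: card_cartesian_product card_lists_length_eq)
qed

lemma leaves_subset_verts: "k \<ge> 3 \<Longrightarrow> leaves n m k \<subseteq> pverts (LSG n m k)"
  by (auto simp: leaves_def LSG_def LSG_verts_def)

lemma leaf_in_subtree:
  assumes "i < n" "set w \<subseteq> {..<m}" "length w + 2 \<le> k" "m > 0"
  obtains x where "x \<in> leaves n m k" "x \<in> subtree i w"
proof
  let ?x = "Node i (replicate (k - 2 - length w) 0 @ w)"
  show "?x \<in> leaves n m k" using assms by (auto simp: leaves_def)
  show "?x \<in> subtree i w" by (auto simp: Node_in_subtree_iff)
qed

lemma leaves_subset_doubly_resolving_set:
  assumes "n \<ge> 3" "k \<ge> 3" "doubly_resolving_set (LSG n m k) S"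
  shows "leaves n m k \<subseteq> S"
proof
  fix x assume "x \<in> leaves n m k"
  then obtain i w where x: "x = Node i w" "i < n" "set w \<subseteq> {..<m}" "length w = k - 2"
    by (auto simp: leaves_def)
  then obtain c w' where w: "w = c # w'" using assms(2) by (cases w) auto
  interpret pair_graph "LSG n m k" using assms(1,2) by (rule pair_graph_LSG)
  show "x \<in> S"
  proof (rule pendant_in_doubly_resolving_set)
    show "doubly_resolving_set (LSG n m k) S" by fact
    show "strongly_connected (LSG n m k)" using assms(1,2) by (rule strongly_connected_LSG)
    show "x \<in> pverts (LSG n m k)" "Node i w' \<in> pverts (LSG n m k)" "Node i w' \<noteq> x"
      using x w by (auto simp: LSG_def LSG_verts_def)
    fix e assume "e \<in> parcs (LSG n m k)" "fst e = x"
    then show "snd e = Node i w'"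
      using x w assms(2) by (auto simp: LSG_def LSG_edges_def)
  qed
qed

text \<open>
  In each case the leaf is chosen in a region that does not contain \<open>v\<close> and that can only be
  entered through \<open>u\<close>: the tree hanging from \<open>u\<close>, including \<open>u\<close>, if \<open>v\<close> lies outside it, and
  otherwise the complement of the subtree that contains \<open>v\<close> and hangs from a child of \<open>u\<close>. Here
  \<open>Node i []\<close> counts as the only child of \<open>Cyc i\<close>; the complement of its subtree still contains
  leaves, namely those of the other trees.
\<close>

lemma geodesic_extends_to_leaf:
  assumes n: "n \<ge> 3" and k: "k \<ge> 3" and m: "m \<ge> 2"
    and u: "u \<in> pverts (LSG n m k)" and v: "v \<in> pverts (LSG n m k)" and "u \<noteq> v"
  shows "\<exists>x \<in> leaves n m k.
    gdist (LSG n m k) v x = gdist (LSG n m k) v u + gdist (LSG n m k) u x"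
proof -
  let ?G = "LSG n m k"
  interpret pair_graph ?G using n k by (rule pair_graph_LSG)
  have via: ?thesis
    if "x \<in> leaves n m k" "x \<in> A" "v \<notin> A"
      and gate: "\<And>a b. (a, b) \<in> parcs ?G \<Longrightarrow> a \<notin> A \<Longrightarrow> b \<in> A \<Longrightarrow> b = u" for x A
  proof (intro bexI gdist_through_gate)
    have "x \<in> pverts ?G" using leaves_subset_verts k that(1) by blast
    then show "v \<rightarrow>\<^sup>*\<^bsub>?G\<^esub> x" using reachable_LSG n k v by blast
    show "v \<notin> A" "x \<in> A" "x \<in> leaves n m k" by fact+
  qed (use gate in auto)
  show ?thesis
  proof (cases u)
    case (Node i w)
    then have w: "i < n" "set w \<subseteq> {..<m}" "length w + 2 \<le> k"
      using u by (auto simp: LSG_def LSG_verts_def)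
    show ?thesis
    proof (cases "v \<in> subtree i w")
      case False
      obtain x where "x \<in> leaves n m k" "x \<in> subtree i w"
        using leaf_in_subtree w m by (metis less_le_trans pos2)
      then show ?thesis
        using False arc_into_subtree[of _ _ n m k i w] Node by (intro via) auto
    next
      case True
      then obtain t where t: "v = Node i (t @ w)" by (auto simp: subtree_def)
      with Node \<open>u \<noteq> v\<close> have "t \<noteq> []" by auto
      then obtain t' c where t': "t = t' @ [c]" by (metis rev_exhaust)
      then have v': "v \<in> subtree i (c # w)" using t by (auto simp: Node_in_subtree_iff)
      have lw: "length w + 3 \<le> k" using v t t' by (auto simp: LSG_def LSG_verts_def)
      define d where "d = (if c = 0 then 1 else 0 :: nat)"
      have d: "d < m" "d \<noteq> c" using m by (auto simp: d_def)
      obtain x where x: "x \<in> leaves n m k" "x \<in> subtree i (d # w)"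
        using leaf_in_subtree[of i n "d # w" m k] w lw d m by auto
      then have "x \<in> - subtree i (c # w)" using d by (auto simp: subtree_def)
      moreover have "v \<notin> - subtree i (c # w)" using v' by simp
      ultimately show ?thesis
        using x(1) arc_out_of_subtree[of _ _ n m k i "c # w"] Node
        by (intro via[of x "- subtree i (c # w)"]) auto
    qed
  next
    case (Cyc i)
    then have i: "i < n" using u by (auto simp: LSG_def LSG_verts_def)
    show ?thesis
    proof (cases "v \<in> subtree i []")
      case False
      obtain x where "x \<in> leaves n m k" "x \<in> subtree i []"
        using leaf_in_subtree[of i n "[]" m k] i k m by auto
      then show ?thesis
        using False Cyc \<open>u \<noteq> v\<close> arc_into_branch
        by (intro via[of x "insert (Cyc i) (subtree i [])"]) auto
    next
      case True
      define j where "j = (if i = 0 then 1 else 0 :: nat)"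
      have j: "j < n" "j \<noteq> i" using n by (auto simp: j_def)
      obtain x where x: "x \<in> leaves n m k" "x \<in> subtree j []"
        using leaf_in_subtree[of j n "[]" m k] j k m by auto
      then have "x \<in> - subtree i []" using j by (auto simp: subtree_def)
      moreover have "v \<notin> - subtree i []" using True by simp
      ultimately show ?thesis
        using x(1) arc_out_of_subtree[of _ _ n m k i "[]"] Cyc
        by (intro via[of x "- subtree i []"]) auto
    qed
  qed
qed

lemma doubly_resolving_set_leaves:
  assumes "n \<ge> 3" "k \<ge> 3" "m \<ge> 2"
  shows "doubly_resolving_set (LSG n m k) (leaves n m k)"
  unfolding doubly_resolving_set_def
proof (intro conjI ballI impI)
  interpret pair_graph "LSG n m k" using assms(1,2) by (rule pair_graph_LSG)
  show "leaves n m k \<subseteq> verts (LSG n m k)" using leaves_subset_verts assms by simp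
  fix u v assume uv: "u \<in> verts (LSG n m k)" "v \<in> verts (LSG n m k)" "u \<noteq> v"
  then have reach: "u \<rightarrow>\<^sup>*\<^bsub>LSG n m k\<^esub> v" using reachable_LSG assms by simp
  obtain x where "x \<in> leaves n m k"
    "gdist (LSG n m k) v x = gdist (LSG n m k) v u + gdist (LSG n m k) u x"
    using geodesic_extends_to_leaf[of n k m u v] assms uv by auto
  moreover obtain y where "y \<in> leaves n m k"
    "gdist (LSG n m k) u y = gdist (LSG n m k) u v + gdist (LSG n m k) v y"
    using geodesic_extends_to_leaf[of n k m v u] assms uv by auto
  ultimately show "\<exists>x\<in>leaves n m k. \<exists>y\<in>leaves n m k. doubly_resolve (LSG n m k) x y u v"
    using doubly_resolve_by_extended_geodesics reach uv(3) by blast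
qed

theorem theorem3p2:
  fixes n m k :: nat
  assumes "n \<ge> 3" and "k \<ge> 3" and "m \<ge> 2"
  shows "psi (LSG n m k) = n * m ^ (k - 2)"
  unfolding psi_def
proof (rule Least_equality)
  show "\<exists>S. finite S \<and> doubly_resolving_set (LSG n m k) S \<and> card S = n * m ^ (k - 2)"
    using finite_leaves_card_leaves[of n m k] doubly_resolving_set_leaves[OF assms]
    by (intro exI[of _ "leaves n m k"]) simp
next
  fix s assume "\<exists>S. finite S \<and> doubly_resolving_set (LSG n m k) S \<and> card S = s"
  then obtain S where S: "finite S" "doubly_resolving_set (LSG n m k) S" "card S = s" by blast
  then have "card (leaves n m k) \<le> s"
    using card_mono leaves_subset_doubly_resolving_set[OF assms(1,2)] by blast
  then show "n * m ^ (k - 2) \<le> s" by (simp add: finite_leaves_card_leaves)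
qed

end
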